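(* Let $G=(V,E)$ be a graph with at least one node and without isolated nodes, and let $M$ be the maximum of $\left\lceil \frac{|S|}{|N(S)|}\right\rceil$ over all non-empty stable sets $S$ of $G$. If $M\neq 1$, then the minimum number of matchings of $G$ that cover all nodes of $G$ is equal to $M$. If $M=1$, then this minimum number is $1$ if $G$ has a perfect matching, and $2$ if $G$ has no perfect matching.
   Context: Graphs are finite and simple (no loops or parallel edges). A matching is a set of pairwise node-disjoint edges. An edge set covers a node if some edge of the set is incident to that node; a family of matchings covers the nodes covered by its union. A matching is perfect if it covers $V$. A stable set is a set of pairwise non-adjacent nodes. For $U\subseteq V$, $N(U)=\{v\in V\setminus U:\text{ there exists }u\in U\text{ with }uv\in E\}$. An isolated node is a node with no incident edge; since there are none, $N(S)\neq\emptyset$ for every non-empty stable set $S$. *)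

theory Defs
  imports Complex_Main
begin

(* Requiring card e = 2 excludes loops, and E being a set of edges excludes parallel edges. *)
definition finite_simple_graph :: "'a set \<Rightarrow> 'a set set \<Rightarrow> bool" where
  "finite_simple_graph V E \<longleftrightarrow> finite V \<and> (\<forall>e\<in>E. e \<subseteq> V \<and> card e = 2)"

definition isolated_node :: "'a set \<Rightarrow> 'a set set \<Rightarrow> 'a \<Rightarrow> bool" where
  "isolated_node V E v \<longleftrightarrow> v \<in> V \<and> (\<forall>e\<in>E. v \<notin> e)"

definition is_matching :: "'a set set \<Rightarrow> 'a set set \<Rightarrow> bool" where
  "is_matching E M \<longleftrightarrow> M \<subseteq> E \<and> pairwise disjnt M"

definition covers :: "'a set set \<Rightarrow> 'a set \<Rightarrow> bool" where
  "covers F U \<longleftrightarrow> (\<forall>v\<in>U. \<exists>e\<in>F. v \<in> e)"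

definition is_perfect_matching :: "'a set \<Rightarrow> 'a set set \<Rightarrow> 'a set set \<Rightarrow> bool" where
  "is_perfect_matching V E M \<longleftrightarrow> is_matching E M \<and> covers M V"

definition stable_set :: "'a set \<Rightarrow> 'a set set \<Rightarrow> 'a set \<Rightarrow> bool" where
  "stable_set V E S \<longleftrightarrow> S \<subseteq> V \<and> (\<forall>u\<in>S. \<forall>v\<in>S. {u, v} \<notin> E)"

definition neighbours :: "'a set \<Rightarrow> 'a set set \<Rightarrow> 'a set \<Rightarrow> 'a set" where
  "neighbours V E U = {v \<in> V - U. \<exists>u\<in>U. {u, v} \<in> E}"

definition stable_ratios :: "'a set \<Rightarrow> 'a set set \<Rightarrow> int set" where
  "stable_ratios V E =
     {\<lceil>real (card S) / real (card (neighbours V E S))\<rceil> | S. stable_set V E S \<and> S \<noteq> {}}"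

definition max_stable_ratio :: "'a set \<Rightarrow> 'a set set \<Rightarrow> int" where
  "max_stable_ratio V E = Max (stable_ratios V E)"

definition coverable_by_matchings :: "'a set \<Rightarrow> 'a set set \<Rightarrow> nat \<Rightarrow> bool" where
  "coverable_by_matchings V E k \<longleftrightarrow>
     (\<exists>\<M>. finite \<M> \<and> card \<M> = k \<and> (\<forall>M\<in>\<M>. is_matching E M) \<and> covers (\<Union>\<M>) V)"

definition matching_cover_number :: "'a set \<Rightarrow> 'a set set \<Rightarrow> nat" where
  "matching_cover_number V E = (LEAST k. coverable_by_matchings V E k)"

(* The next three lemmas show that the LEAST and the Max are attained, and that no ratio
   divides by zero, for the graphs considered. *)

lemma matching_cover_number_attained:
  assumes "finite_simple_graph V E" and "\<forall>v\<in>V. \<not> isolated_node V E v"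
  shows "coverable_by_matchings V E (matching_cover_number V E)"
proof -
  let ?F = "(\<lambda>e. {e}) ` E"
  have "E \<subseteq> Pow V" "finite V"
    using assms(1) by (auto simp: finite_simple_graph_def)
  then have "finite ?F"
    by (meson finite_Pow_iff finite_imageI finite_subset)
  moreover have "\<forall>M\<in>?F. is_matching E M"
    by (auto simp: is_matching_def)
  moreover have "covers (\<Union>?F) V"
    using assms(2) by (auto simp: covers_def isolated_node_def)
  ultimately have "coverable_by_matchings V E (card ?F)"
    unfolding coverable_by_matchings_def by blast
  then show ?thesis
    unfolding matching_cover_number_def by (rule LeastI)
qed

lemma finite_nonempty_stable_ratios:
  assumes "finite_simple_graph V E" and "V \<noteq> {}"
  shows "finite (stable_ratios V E)" and "stable_ratios V E \<noteq> {}"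
proof -
  let ?f = "\<lambda>S. \<lceil>real (card S) / real (card (neighbours V E S))\<rceil>"
  have "stable_ratios V E \<subseteq> ?f ` Pow V"
    by (auto simp: stable_ratios_def stable_set_def)
  moreover have "finite V"
    using assms(1) by (auto simp: finite_simple_graph_def)
  ultimately show "finite (stable_ratios V E)"
    by (meson finite_Pow_iff finite_imageI finite_subset)
  obtain v where "v \<in> V"
    using assms(2) by blast
  moreover have "{v} \<notin> E"
    using assms(1) by (force simp: finite_simple_graph_def)
  ultimately have "stable_set V E {v}"
    by (simp add: stable_set_def)
  then show "stable_ratios V E \<noteq> {}"
    unfolding stable_ratios_def by blast
qed

lemma card_neighbours_pos:
  assumes "finite_simple_graph V E" and "\<forall>v\<in>V. \<not> isolated_node V E v"
    and "stable_set V E S" and "S \<noteq> {}"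
  shows "card (neighbours V E S) > 0"
proof -
  obtain u where u: "u \<in> S" "u \<in> V"
    using assms(3,4) by (auto simp: stable_set_def)
  then obtain e where e: "e \<in> E" "u \<in> e"
    using assms(2) by (auto simp: isolated_node_def)
  then have "e \<subseteq> V" "card e = 2"
    using assms(1) by (auto simp: finite_simple_graph_def)
  then obtain v where v: "e = {u, v}" "v \<in> V"
    using e(2) by (auto simp: card_2_iff)
  then have "v \<in> neighbours V E S"
    using e u assms(3) by (auto simp: neighbours_def stable_set_def)
  moreover have "finite (neighbours V E S)"
    using assms(1) by (auto simp: neighbours_def finite_simple_graph_def)
  ultimately show ?thesis
    by (auto simp: card_gt_0_iff)
qed

end

theory Submission
  imports Defs
begin

text \<open>
  A family of \<open>k\<close> matchings can cover a stable set \<open>S\<close> only if \<open>card S \<le> k * card N(S)\<close>: the edge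
  that covers a node of \<open>S\<close> ends in \<open>N(S)\<close>, and each node of \<open>N(S)\<close> is used at most once by each
  matching. So \<open>M\<close> is a lower bound (lemma \<open>stable_card_le_of_cover\<close>). The work is to show
  that for \<open>k \<ge> 2\<close> the condition \<open>card S \<le> k * card N(S)\<close> for all stable \<open>S\<close> is also
  sufficient.

  The condition extends from stable sets to all sets \<open>X\<close> of nodes, if \<open>N(S)\<close> is replaced by
  the set of all nodes, inside \<open>X\<close> or not, that are adjacent to a node of \<open>X\<close>: the nodes of
  \<open>X\<close> without neighbour in \<open>X\<close> form a stable set, and the other nodes of \<open>X\<close> are
  themselves adjacent to \<open>X\<close>. Hall's theorem, with \<open>k\<close> copies of each node, then
  assigns to each node \<open>v\<close> a neighbour \<open>f v\<close> and a colour \<open>g v < k\<close> such that nodes with the same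
  image have different colours (lemma \<open>coloured_neighbour_assignment\<close>).

  The edges \<open>{v, f v}\<close> cover all nodes, but an edge that leaves a node may have the colour of
  an edge that enters it. Lemma \<open>coloured_arc_cover\<close> repairs this. Among the sets \<open>D\<close> that are
  disjoint from \<open>f ` D\<close>, take one for which \<open>D \<union> f ` D\<close> is as large as possible. The arcs that
  start in \<open>D\<close> form stars, properly coloured by \<open>g\<close>. By the choice of \<open>D\<close>, every
  uncovered node \<open>w\<close> has \<open>f w \<in> D\<close>, and different uncovered nodes have different images. So each
  uncovered node can be joined to a leaf of a star, at most one per leaf, and the new edge only has
  to avoid the colour of one other edge. Two colours are enough for that; this is where
  \<open>k \<ge> 2\<close> enters, and why \<open>M = 1\<close> is an exception.
\<close>

section \<open>Hall's theorem\<close>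

text \<open>
  Rado's argument. If some \<open>A i\<close> has two elements, one of them can be deleted without
  violating Hall's condition: otherwise there are sets \<open>X\<close> and \<open>Y\<close> of indices
  that violate it together with \<open>i\<close> after the one and the other deletion, and submodularity of the
  size of a union contradicts Hall's condition for \<open>X \<inter> Y\<close> and \<open>insert i (X \<union> Y)\<close>. If all \<open>A i\<close>
  are singletons, Hall's condition for pairs of indices says that they are distinct.
\<close>

lemma hall:
  fixes A :: "'i \<Rightarrow> 'b set"
  assumes "finite I" and "\<And>i. i \<in> I \<Longrightarrow> finite (A i)"
    and "\<And>X. X \<subseteq> I \<Longrightarrow> card X \<le> card (\<Union> (A ` X))"
  shows "\<exists>h. (\<forall>i\<in>I. h i \<in> A i) \<and> inj_on h I"
  using assms(2,3)
proof (induction "\<Sum>i\<in>I. card (A i)" arbitrary: A rule: less_induct)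
  case less
  note fin = less.prems(1) and hc = less.prems(2)
  show ?case
  proof (cases "\<exists>i\<in>I. \<exists>x\<in>A i. \<exists>y\<in>A i. x \<noteq> y")
    case True
    then obtain i x y where i: "i \<in> I" "x \<in> A i" "y \<in> A i" "x \<noteq> y" by blast
    define B where "B z = A(i := A i - {z})" for z
    have finB: "finite (B z j)" if "j \<in> I" for z j
      using fin[OF that] fin by (auto simp: B_def)
    have smaller: "(\<Sum>j\<in>I. card (B z j)) < (\<Sum>j\<in>I. card (A j))" if "z \<in> A i" for z
    proof (rule sum_strict_mono_ex1)
      show "\<forall>j\<in>I. card (B z j) \<le> card (A j)"
        using fin by (auto simp: B_def intro: card_mono)
      show "\<exists>j\<in>I. card (B z j) < card (A j)"
        using i(1) that fin card_Diff1_less[of "A i" z]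
        by (auto simp: B_def intro!: bexI[of _ i])
    qed (use assms(1) in simp)
    have solved: ?thesis
      if z: "z \<in> A i" and hcB: "\<And>X. X \<subseteq> I \<Longrightarrow> card X \<le> card (\<Union> (B z ` X))" for z
    proof -
      obtain h where "\<forall>j\<in>I. h j \<in> B z j" "inj_on h I"
        using less.hyps[OF smaller[OF z] finB hcB] by blast
      then show ?thesis
        by (intro exI[of _ h]) (auto simp: B_def split: if_splits)
    qed
    have violated: "\<exists>X\<subseteq>I - {i}. card (\<Union> (A ` X) \<union> (A i - {z})) \<le> card X"
      if bad: "\<not> (\<forall>X\<subseteq>I. card X \<le> card (\<Union> (B z ` X)))" for z
    proof -
      obtain X where X: "X \<subseteq> I" "card (\<Union> (B z ` X)) < card X"
        using bad by (auto simp: not_le)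
      have "i \<in> X"
      proof (rule ccontr)
        assume "i \<notin> X"
        then have "\<Union> (B z ` X) = \<Union> (A ` X)" by (auto simp: B_def)
        then show False using X hc[of X] by simp
      qed
      then have "\<Union> (B z ` X) = \<Union> (A ` (X - {i})) \<union> (A i - {z})"
        by (auto simp: B_def split: if_splits)
      moreover have "card X = Suc (card (X - {i}))"
        using \<open>i \<in> X\<close> X(1) assms(1) by (meson card.remove finite_subset)
      ultimately show ?thesis using X by (intro exI[of _ "X - {i}"]) auto
    qed
    show ?thesis
    proof (rule ccontr)
      assume no: "\<not> ?thesis"
      obtain X where X: "X \<subseteq> I - {i}" "card (\<Union> (A ` X) \<union> (A i - {x})) \<le> card X"
        using violated[of x] solved[OF i(2)] no by blast
      obtain Y where Y: "Y \<subseteq> I - {i}" "card (\<Union> (A ` Y) \<union> (A i - {y})) \<le> card Y"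
        using violated[of y] solved[OF i(3)] no by blast
      let ?P = "\<Union> (A ` X) \<union> (A i - {x})" and ?Q = "\<Union> (A ` Y) \<union> (A i - {y})"
      have finX: "finite X" "finite Y"
        using X(1) Y(1) assms(1) by (auto intro: finite_subset)
      have finPQ: "finite ?P" "finite ?Q"
        using finX X(1) Y(1) fin i(1) by auto
      have "card X + card Y + 1 = card (insert i (X \<union> Y)) + card (X \<inter> Y)"
      proof -
        have "i \<notin> X \<union> Y" using X(1) Y(1) by blast
        then show ?thesis using finX card_Un_Int[of X Y] by simp
      qed
      also have "\<dots> \<le> card (\<Union> (A ` insert i (X \<union> Y))) + card (\<Union> (A ` (X \<inter> Y)))"
        using X(1) Y(1) i(1) by (intro add_mono hc) auto
      also have "\<dots> \<le> card (?P \<union> ?Q) + card (?P \<inter> ?Q)"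
        using finPQ i by (intro add_mono card_mono) auto
      also have "\<dots> = card ?P + card ?Q"
        by (rule card_Un_Int[OF finPQ, symmetric])
      finally show False using X(2) Y(2) by simp
    qed
  next
    case False
    have nonempty: "\<exists>x. x \<in> A i" if "i \<in> I" for i
      using hc[of "{i}"] that by (cases "A i = {}") auto
    define h where "h i = (SOME x. x \<in> A i)" for i
    have h: "h i \<in> A i" if "i \<in> I" for i
      unfolding h_def using nonempty[OF that] by (rule someI_ex)
    have "inj_on h I"
    proof (rule inj_onI, rule ccontr)
      fix i j assume ij: "i \<in> I" "j \<in> I" "h i = h j" "i \<noteq> j"
      then have "\<Union> (A ` {i, j}) = {h i}"
        using False h[of i] h[of j] by auto
      then show False using hc[of "{i, j}"] ij by simp
    qed
    then show ?thesis using h by blast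
  qed
qed

section \<open>Assigning coloured neighbours\<close>

text \<open>
  The right-hand side counts all nodes adjacent to \<open>X\<close>, also those in \<open>X\<close>. Both \<open>N(S)\<close>, for
  the set \<open>S\<close> of isolated nodes of the subgraph induced by \<open>X\<close>, and \<open>X - S\<close> are contained in that
  set, and they are disjoint.
\<close>

lemma card_le_adjacent:
  assumes G: "finite_simple_graph V E" and k: "k \<ge> 1"
    and stable: "\<And>S. stable_set V E S \<Longrightarrow> card S \<le> k * card (neighbours V E S)"
    and X: "X \<subseteq> V"
  shows "card X \<le> k * card (\<Union>v\<in>X. {u \<in> V. {v, u} \<in> E})"
proof -
  let ?\<Gamma> = "\<Union>v\<in>X. {u \<in> V. {v, u} \<in> E}"
  define S where "S = {v \<in> X. \<forall>u\<in>X. {v, u} \<notin> E}"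
  have finV: "finite V" using G by (simp add: finite_simple_graph_def)
  then have finX: "finite X" using X by (rule finite_subset[rotated])
  have finN: "finite (neighbours V E S)" using finV by (simp add: neighbours_def)
  have SX: "S \<subseteq> X" by (auto simp: S_def)
  have "stable_set V E S" using X by (auto simp: stable_set_def S_def)
  have "card X = card S + card (X - S)"
    using finX SX by (metis card_Diff_subset card_mono finite_subset le_add_diff_inverse)
  also have "\<dots> \<le> k * card (neighbours V E S) + k * card (X - S)"
    using stable[OF \<open>stable_set V E S\<close>] k by (intro add_mono) auto
  also have "\<dots> = k * card (neighbours V E S \<union> (X - S))"
  proof -
    have "neighbours V E S \<inter> (X - S) = {}"
      by (auto simp: neighbours_def S_def)
    then show ?thesis using finX finN by (simp add: card_Un_disjoint distrib_left)
  qed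
  also have "\<dots> \<le> k * card ?\<Gamma>"
  proof -
    have "neighbours V E S \<union> (X - S) \<subseteq> ?\<Gamma>"
    proof
      fix u assume u: "u \<in> neighbours V E S \<union> (X - S)"
      then have "\<exists>v\<in>X. {v, u} \<in> E"
        using SX by (auto simp: neighbours_def S_def insert_commute)
      moreover have "u \<in> V" using u X by (auto simp: neighbours_def)
      ultimately show "u \<in> ?\<Gamma>" by blast
    qed
    moreover have "finite ?\<Gamma>" using finV finX by auto
    ultimately show ?thesis by (intro mult_le_mono2 card_mono)
  qed
  finally show ?thesis .
qed

text \<open>
  Hall's theorem is applied to pairs of a neighbour and a colour, so that a system of distinct
  representatives gives at once a choice of neighbours and a colouring of its fibres.
\<close>

lemma coloured_neighbour_assignment:
  assumes G: "finite_simple_graph V E" and k: "k \<ge> 1"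
    and stable: "\<And>S. stable_set V E S \<Longrightarrow> card S \<le> k * card (neighbours V E S)"
  shows "\<exists>f g. (\<forall>v\<in>V. f v \<in> V \<and> {v, f v} \<in> E \<and> g v < k) \<and> inj_on (\<lambda>v. (f v, g v :: nat)) V"
proof -
  have finV: "finite V" using G by (simp add: finite_simple_graph_def)
  let ?\<Gamma> = "\<lambda>v. {u \<in> V. {v, u} \<in> E}"
  have "\<exists>h. (\<forall>v\<in>V. h v \<in> ?\<Gamma> v \<times> {..<k}) \<and> inj_on h V"
  proof (rule hall)
    fix X assume X: "X \<subseteq> V"
    have "(\<Union>v\<in>X. ?\<Gamma> v \<times> {..<k}) = (\<Union>v\<in>X. ?\<Gamma> v) \<times> {..<k}" by auto
    then show "card X \<le> card (\<Union>v\<in>X. ?\<Gamma> v \<times> {..<k})"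
      using card_le_adjacent[OF G k stable X] by (simp add: card_cartesian_product mult.commute)
  qed (use finV in auto)
  then obtain h where h: "\<forall>v\<in>V. h v \<in> ?\<Gamma> v \<times> {..<k}" "inj_on h V" by blast
  show ?thesis
    using h by (intro exI[of _ "fst \<circ> h"] exI[of _ "snd \<circ> h"]) (auto simp: mem_Times_iff)
qed

section \<open>From assignments to matchings\<close>

text \<open>
  The arcs \<open>v \<rightarrow> f v\<close> with \<open>v \<in> D\<close> cover all nodes, and arcs of the same colour \<open>c\<close> are
  disjoint. The proof starts from a set of arcs that form disjoint stars, chosen to cover as
  many nodes as possible, and adds the arcs that start at the uncovered nodes.
\<close>

lemma coloured_arc_cover:
  fixes f :: "'a \<Rightarrow> 'a" and g :: "'a \<Rightarrow> nat"
  assumes finV: "finite V" and k: "k \<ge> 2"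
    and f: "\<And>v. v \<in> V \<Longrightarrow> f v \<in> V" "\<And>v. v \<in> V \<Longrightarrow> f v \<noteq> v"
    and g: "\<And>v. v \<in> V \<Longrightarrow> g v < k" and inj: "inj_on (\<lambda>v. (f v, g v)) V"
  shows "\<exists>D c. D \<subseteq> V \<and> V \<subseteq> D \<union> f ` D \<and> (\<forall>v\<in>D. c v < k) \<and>
    (\<forall>u\<in>D. \<forall>v\<in>D. u \<noteq> v \<longrightarrow> c u = c v \<longrightarrow> disjnt {u, f u} {v, f v})"
proof -
  define good where "good D \<longleftrightarrow> D \<subseteq> V \<and> D \<inter> f ` D = {}" for D
  have fin: "finite (D \<union> f ` D)" if "good D" for D
    using that finV by (auto simp: good_def intro: finite_subset)
  have "\<exists>D. good D \<and> (\<forall>D'. good D' \<longrightarrow> card (D' \<union> f ` D') \<le> card (D \<union> f ` D))"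
  proof (rule ex_has_greatest_nat)
    show "good {}" by (simp add: good_def)
    show "\<forall>D. good D \<longrightarrow> card (D \<union> f ` D) < Suc (card V)"
      using finV f(1) by (auto simp: good_def less_Suc_eq_le intro!: card_mono)
  qed
  then obtain D where D: "good D"
    and best: "\<And>D'. good D' \<Longrightarrow> card (D' \<union> f ` D') \<le> card (D \<union> f ` D)" by blast
  define W where "W = V - (D \<union> f ` D)"
  have DV: "D \<subseteq> V" and disj: "D \<inter> f ` D = {}" using D by (auto simp: good_def)
  have fW: "f w \<in> D" if "w \<in> W" for w
  proof (rule ccontr)
    assume "f w \<notin> D"
    then have good': "good (insert w D)"
      using that DV disj f(2) by (auto simp: good_def W_def)
    have "card (D \<union> f ` D) < card (insert w D \<union> f ` insert w D)"
      using that fin[OF good'] by (intro psubset_card_mono) (auto simp: W_def)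
    then show False using best[OF good'] by simp
  qed
  \<comment> \<open>If two uncovered nodes had the same image \<open>x\<close>, they could replace \<open>x\<close> in \<open>D\<close>: at most the node
      \<open>f x\<close> would get lost, and two nodes would be gained.\<close>
  have injW: "w = w'" if w: "w \<in> W" "w' \<in> W" "f w = f w'" for w w'
  proof (rule ccontr)
    assume ne: "w \<noteq> w'"
    define x where "x = f w"
    define D' where "D' = insert w (insert w' (D - {x}))"
    have x: "x \<in> D" "x \<notin> W" using fW[OF w(1)] by (auto simp: x_def W_def)
    have good': "good D'"
      using w x DV disj by (auto simp: good_def D'_def W_def x_def)
    let ?K = "D \<union> f ` D"
    have sub: "insert w (insert w' (?K - {f x})) \<subseteq> D' \<union> f ` D'"
      using w by (auto simp: D'_def x_def)
    have "f x \<in> ?K" using x by blast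
    then have "card ?K = Suc (card (?K - {f x}))"
      using card_Suc_Diff1[OF fin[OF D]] by metis
    also have "\<dots> < card (insert w (insert w' (?K - {f x})))"
      using fin[OF D] ne w by (simp add: W_def)
    also have "\<dots> \<le> card (D' \<union> f ` D')"
      using fin[OF good'] sub by (rule card_mono)
    finally show False using best[OF good'] by simp
  qed
  \<comment> \<open>The arc from an uncovered node \<open>w\<close> meets exactly one other arc, the one from \<open>f w\<close> to the
      centre of its star, and takes one of the colours 0 and 1 that this arc does not have.\<close>
  define c where "c v = (if v \<in> W then if g (f v) = 0 then 1 else 0 else g v)" for v
  have cW: "c w < k \<and> c w \<noteq> c (f w)" if "w \<in> W" for w
    using that fW[OF that] k by (auto simp: c_def W_def)
  have cD: "c v = g v" if "v \<in> D" for v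
    using that by (simp add: c_def W_def)
  have DD: "disjnt {u, f u} {v, f v}" if "u \<in> D" "v \<in> D" "u \<noteq> v" "c u = c v" for u v
  proof -
    have "f u \<noteq> f v" using inj_onD[OF inj, of u v] that cD DV by auto
    then show ?thesis using that disj by (auto simp: disjnt_def)
  qed
  have DW: "disjnt {u, f u} {w, f w}" if "u \<in> D" "w \<in> W" "c u = c w" for u w
    using that fW[OF that(2)] cW[OF that(2)] disj by (auto simp: disjnt_def W_def)
  have WW: "disjnt {v, f v} {w, f w}" if "v \<in> W" "w \<in> W" "v \<noteq> w" for v w
    using that fW[OF that(1)] fW[OF that(2)] injW[OF that(1,2)]
    by (auto simp: disjnt_def W_def)
  show ?thesis
  proof (intro exI conjI ballI impI)
    show "D \<union> W \<subseteq> V" using DV by (auto simp: W_def)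
    show "V \<subseteq> (D \<union> W) \<union> f ` (D \<union> W)" by (auto simp: W_def)
    show "c v < k" if "v \<in> D \<union> W" for v
      using that cW cD g DV by auto
    show "disjnt {u, f u} {v, f v}"
      if "u \<in> D \<union> W" "v \<in> D \<union> W" "u \<noteq> v" "c u = c v" for u v
      using that DD DW[of u v] DW[of v u] WW by (metis UnE disjnt_sym)
  qed
qed

section \<open>The matching cover number\<close>

lemma matching_cover_number_le:
  assumes G: "finite_simple_graph V E" and k: "k \<ge> 2"
    and stable: "\<And>S. stable_set V E S \<Longrightarrow> card S \<le> k * card (neighbours V E S)"
  shows "matching_cover_number V E \<le> k"
proof -
  have finV: "finite V" using G by (simp add: finite_simple_graph_def)
  obtain f g where fg: "\<And>v. v \<in> V \<Longrightarrow> f v \<in> V \<and> {v, f v} \<in> E \<and> g v < k"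
      "inj_on (\<lambda>v. (f v, g v :: nat)) V"
    using coloured_neighbour_assignment[OF G _ stable] k by auto
  have ne: "f v \<noteq> v" if "v \<in> V" for v
    using fg(1)[OF that] G by (force simp: finite_simple_graph_def)
  have "\<exists>D c. D \<subseteq> V \<and> V \<subseteq> D \<union> f ` D \<and> (\<forall>v\<in>D. c v < k) \<and>
      (\<forall>u\<in>D. \<forall>v\<in>D. u \<noteq> v \<longrightarrow> c u = c v \<longrightarrow> disjnt {u, f u} {v, f v})"
    by (rule coloured_arc_cover[OF finV k _ ne _ fg(2)]) (use fg(1) in auto)
  then obtain D and c :: "'a \<Rightarrow> nat" where D: "D \<subseteq> V" "V \<subseteq> D \<union> f ` D" and c: "\<forall>v\<in>D. c v < k"
      and dis: "\<forall>u\<in>D. \<forall>v\<in>D. u \<noteq> v \<longrightarrow> c u = c v \<longrightarrow> disjnt {u, f u} {v, f v}"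
    by (elim exE conjE)
  define Mt where "Mt i = {{v, f v} | v. v \<in> D \<and> c v = i}" for i
  have "is_matching E (Mt i)" for i
    unfolding is_matching_def
  proof
    show "Mt i \<subseteq> E" using fg(1) D(1) by (auto simp: Mt_def)
    show "pairwise disjnt (Mt i)"
    proof (rule pairwiseI)
      fix e e' assume e: "e \<in> Mt i" and e': "e' \<in> Mt i" and ne': "e \<noteq> e'"
      obtain u where u: "e = {u, f u}" "u \<in> D" "c u = i"
        using e unfolding Mt_def mem_Collect_eq by (elim exE conjE)
      obtain v where v: "e' = {v, f v}" "v \<in> D" "c v = i"
        using e' unfolding Mt_def mem_Collect_eq by (elim exE conjE)
      have "u \<noteq> v" using u(1) v(1) ne' by auto
      then show "disjnt e e'" using dis u v by simp
    qed
  qed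
  moreover have "covers (\<Union> (Mt ` {..<k})) V"
    unfolding covers_def
  proof
    fix v assume "v \<in> V"
    then have "v \<in> D \<union> f ` D" using D(2) by (rule subsetD[rotated])
    then obtain u where u: "u \<in> D" "v \<in> {u, f u}" by blast
    then have "{u, f u} \<in> Mt (c u)" "c u < k" using c by (auto simp: Mt_def)
    then show "\<exists>e\<in>\<Union> (Mt ` {..<k}). v \<in> e" using u(2) by blast
  qed
  ultimately have "coverable_by_matchings V E (card (Mt ` {..<k}))"
    unfolding coverable_by_matchings_def by blast
  then have "matching_cover_number V E \<le> card (Mt ` {..<k})"
    unfolding matching_cover_number_def by (rule Least_le)
  also have "\<dots> \<le> k" using card_image_le[of "{..<k}" Mt] by simp
  finally show ?thesis .
qed

text \<open>
  Send each node \<open>v\<close> of \<open>S\<close> to a matching that covers \<open>v\<close> and to the partner of \<open>v\<close> in that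
  matching. The partner lies in \<open>N(S)\<close>, and together they determine \<open>v\<close>.
\<close>

lemma stable_card_le_of_cover:
  assumes G: "finite_simple_graph V E" and cov: "coverable_by_matchings V E k"
    and S: "stable_set V E S"
  shows "card S \<le> k * card (neighbours V E S)"
proof -
  obtain \<M> where \<M>: "finite \<M>" "card \<M> = k" "\<And>P. P \<in> \<M> \<Longrightarrow> is_matching E P" "covers (\<Union>\<M>) V"
    using cov by (auto simp: coverable_by_matchings_def)
  have "\<exists>p. p \<in> \<M> \<times> neighbours V E S \<and> {v, snd p} \<in> fst p" if "v \<in> S" for v
  proof -
    have "v \<in> V" using that S by (auto simp: stable_set_def)
    then obtain P e where e: "P \<in> \<M>" "e \<in> P" "v \<in> e"
      using \<M>(4) by (auto simp: covers_def)
    then have "e \<in> E" using \<M>(3) by (auto simp: is_matching_def)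
    then have "card e = 2" "e \<subseteq> V" using G by (auto simp: finite_simple_graph_def)
    then obtain u where u: "e = {v, u}" "u \<in> V" using e(3) by (auto simp: card_2_iff)
    then have "u \<in> neighbours V E S"
      using that S \<open>e \<in> E\<close> by (auto simp: neighbours_def stable_set_def)
    then show ?thesis using e u by (intro exI[of _ "(P, u)"]) auto
  qed
  then obtain p where p: "\<And>v. v \<in> S \<Longrightarrow> p v \<in> \<M> \<times> neighbours V E S \<and> {v, snd (p v)} \<in> fst (p v)"
    by metis
  have "inj_on p S"
  proof (rule inj_onI)
    fix v w assume vw: "v \<in> S" "w \<in> S" "p v = p w"
    have "pairwise disjnt (fst (p v))"
      using p[OF vw(1)] \<M>(3) by (auto simp: is_matching_def)
    moreover have "{v, snd (p v)} \<in> fst (p v)" "{w, snd (p v)} \<in> fst (p v)"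
      using p[OF vw(1)] p[OF vw(2)] vw(3) by auto
    moreover have "\<not> disjnt {v, snd (p v)} {w, snd (p v)}"
      by (simp add: disjnt_def)
    ultimately have "{v, snd (p v)} = {w, snd (p v)}"
      by (meson pairwiseD)
    then show "v = w" by (auto simp: doubleton_eq_iff)
  qed
  moreover have "p ` S \<subseteq> \<M> \<times> neighbours V E S" using p by blast
  moreover have "finite (\<M> \<times> neighbours V E S)"
    using \<M>(1) G by (auto simp: neighbours_def finite_simple_graph_def)
  ultimately have "card S \<le> card (\<M> \<times> neighbours V E S)"
    by (rule card_inj_on_le)
  then show ?thesis using \<M>(2) by (simp add: card_cartesian_product)
qed

lemma max_stable_ratio_le_iff:
  assumes G: "finite_simple_graph V E" and V: "V \<noteq> {}"
    and iso: "\<forall>v\<in>V. \<not> isolated_node V E v"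
  shows "max_stable_ratio V E \<le> int k \<longleftrightarrow>
    (\<forall>S. stable_set V E S \<longrightarrow> card S \<le> k * card (neighbours V E S))"
proof -
  have eq: "\<lceil>real (card S) / real (card (neighbours V E S))\<rceil> \<le> int k \<longleftrightarrow>
      card S \<le> k * card (neighbours V E S)" if "stable_set V E S" "S \<noteq> {}" for S
  proof -
    have "card (neighbours V E S) > 0" using card_neighbours_pos[OF G iso that] .
    then have "\<lceil>real (card S) / real (card (neighbours V E S))\<rceil> \<le> int k \<longleftrightarrow>
        real (card S) \<le> real (k * card (neighbours V E S))"
      by (simp add: ceiling_le_iff pos_divide_le_eq)
    then show ?thesis by (simp only: of_nat_le_iff)
  qed
  have "max_stable_ratio V E \<le> int k \<longleftrightarrow> (\<forall>r\<in>stable_ratios V E. r \<le> int k)"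
    unfolding max_stable_ratio_def using finite_nonempty_stable_ratios[OF G V] by simp
  also have "\<dots> \<longleftrightarrow> (\<forall>S. stable_set V E S \<longrightarrow> S \<noteq> {} \<longrightarrow> card S \<le> k * card (neighbours V E S))"
    using eq by (auto simp: stable_ratios_def)
  also have "\<dots> \<longleftrightarrow> (\<forall>S. stable_set V E S \<longrightarrow> card S \<le> k * card (neighbours V E S))"
    by (metis card.empty zero_le)
  finally show ?thesis .
qed

lemma max_stable_ratio_pos:
  assumes G: "finite_simple_graph V E" and V: "V \<noteq> {}"
    and iso: "\<forall>v\<in>V. \<not> isolated_node V E v"
  shows "max_stable_ratio V E \<ge> 1"
proof (rule ccontr)
  assume "\<not> max_stable_ratio V E \<ge> 1"
  then have none: "stable_set V E S \<Longrightarrow> card S \<le> 0" for S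
    using max_stable_ratio_le_iff[OF G V iso, of 0] by simp
  obtain v where "v \<in> V" using V by blast
  moreover have "{v} \<notin> E" using G by (force simp: finite_simple_graph_def)
  ultimately show False using none[of "{v}"] by (simp add: stable_set_def)
qed

lemma perfect_matching_iff_coverable:
  "(\<exists>P. is_perfect_matching V E P) \<longleftrightarrow> coverable_by_matchings V E 1"
proof
  assume "\<exists>P. is_perfect_matching V E P"
  then obtain P where "is_matching E P" "covers P V" by (auto simp: is_perfect_matching_def)
  then show "coverable_by_matchings V E 1"
    unfolding coverable_by_matchings_def by (intro exI[of _ "{P}"]) auto
next
  assume "coverable_by_matchings V E 1"
  then show "\<exists>P. is_perfect_matching V E P"
    by (auto simp: coverable_by_matchings_def is_perfect_matching_def card_1_singleton_iff)
qed

theorem corollary1: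
  fixes V :: "'a set" and E :: "'a set set"
  assumes "finite_simple_graph V E"
    and "V \<noteq> {}"
    and "\<forall>v\<in>V. \<not> isolated_node V E v"
  shows "(max_stable_ratio V E \<noteq> 1 \<longrightarrow>
            int (matching_cover_number V E) = max_stable_ratio V E) \<and>
         (max_stable_ratio V E = 1 \<longrightarrow>
            matching_cover_number V E =
              (if \<exists>P. is_perfect_matching V E P then 1 else 2))"
proof -
  let ?\<mu> = "matching_cover_number V E" and ?M = "max_stable_ratio V E"
  have attained: "coverable_by_matchings V E ?\<mu>"
    by (rule matching_cover_number_attained) (fact assms)+
  have lower: "?M \<le> int ?\<mu>"
    using max_stable_ratio_le_iff[OF assms] stable_card_le_of_cover[OF assms(1) attained] by blast
  have upper: "?\<mu> \<le> k" if "k \<ge> 2" "?M \<le> int k" for k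
    using matching_cover_number_le[OF assms(1) that(1)] that(2) max_stable_ratio_le_iff[OF assms]
    by blast
  have pos: "?M \<ge> 1" by (rule max_stable_ratio_pos) (fact assms)+
  show ?thesis
  proof (intro conjI impI)
    assume "?M \<noteq> 1"
    then have "?\<mu> \<le> nat ?M" using pos by (intro upper) auto
    then show "int ?\<mu> = ?M" using lower pos by linarith
  next
    assume "?M = 1"
    then have bounds: "1 \<le> ?\<mu>" "?\<mu> \<le> 2" using lower upper[of 2] by auto
    show "?\<mu> = (if \<exists>P. is_perfect_matching V E P then 1 else 2)"
    proof (cases "coverable_by_matchings V E 1")
      case True
      then have "?\<mu> \<le> 1" unfolding matching_cover_number_def by (rule Least_le)
      then show ?thesis using True bounds by (simp add: perfect_matching_iff_coverable)
    next
      case False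
      then have "?\<mu> \<noteq> 1" using attained by metis
      then show ?thesis using False bounds by (simp add: perfect_matching_iff_coverable)
    qed
  qed
qed

end
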